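(* Let $\mathbb{K}$ be a field and let $I\subset\mathbb{K}[x_1,\ldots,x_n]$ be a generic monomial ideal whose minimal set of monomial generators is $$\operatorname{Min}(I)=\{x_1^{c_1},\ldots,x_n^{c_n},X^{\alpha_1},\ldots,X^{\alpha_p}\},$$ with $p\ge 1$, where the $X^{\alpha_k}$ are sorted in (increasing) lex order with variable order $x_1<\cdots<x_n$. Let $\widehat{I}=\langle x_1^{c_1},\ldots,x_n^{c_n},X^{\alpha_1},\ldots,X^{\alpha_{p-1}}\rangle$. Then $$|\operatorname{Irr}(\widehat{I})|\le|\operatorname{Irr}(I)|.$$
   Context: $\mathbb{N}=\{0,1,2,\ldots\}$; for $\alpha=(a_1,\ldots,a_n)\in\mathbb{N}^n$, $X^\alpha=x_1^{a_1}\cdots x_n^{a_n}$. The exponents $c_1,\ldots,c_n$ are positive integers, so the ideals are Artinian (contain a power of each variable). A monomial ideal $I$ is generic if no variable $x_i$ appears with the same non-zero exponent in two distinct minimal monomial generators of $I$. Lex order with $x_1<\cdots<x_n$: $\alpha<_{lex}\beta$ if for some $1\le k\le n$ one has $a_j=b_j$ for $k+1\le j\le n$ and $a_k<b_k$. For $\beta=(b_1,\ldots,b_n)$ with positive integer entries, $m^\beta=\langle x_1^{b_1},\ldots,x_n^{b_n}\rangle$. Every Artinian monomial ideal $I$ can be written uniquely as an irredundant intersection $I=\bigcap_\beta m^\beta$ of such ideals (irredundant: no component can be dropped), and $\operatorname{Irr}(I)$ denotes the finite set of exponent vectors $\beta$ occurring in it. *)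

theory Defs
  imports Complex_Main "HOL-Library.Poly_Mapping"
begin

text \<open>
  The polynomial ring in the variables \<open>x\<^sub>i\<close> (\<open>i\<close> ranging over a finite linearly ordered type
  \<open>'n\<close>, so that \<open>x\<^sub>i < x\<^sub>j\<close> iff \<open>i < j\<close>) over \<open>'k\<close> is the type of finitely supported maps from
  exponent vectors to \<open>'k\<close>, whose ring structure is the convolution product of
  \<^theory>\<open>HOL-Library.Poly_Mapping\<close>.
\<close>

type_synonym 'n expo = "'n \<Rightarrow>\<^sub>0 nat"
type_synonym ('n, 'k) mpoly = "'n expo \<Rightarrow>\<^sub>0 'k"

text \<open>A commutative ring is a module over itself; its submodules are the ideals, so
  \<open>ideal.span S\<close> is the ideal generated by \<open>S\<close>.\<close>

global_interpretation ideal: module "(*) :: 'a::comm_ring_1 \<Rightarrow> 'a \<Rightarrow> 'a"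
  by unfold_locales (simp_all add: algebra_simps)

definition monomial :: "'n expo \<Rightarrow> ('n, 'k::field) mpoly" where
  "monomial \<alpha> = Poly_Mapping.single \<alpha> 1"

definition var :: "'n \<Rightarrow> ('n, 'k::field) mpoly" where
  "var i = monomial (Poly_Mapping.single i 1)"

lemma var_power: "var i ^ e = monomial (Poly_Mapping.single i e)"
proof (induction e)
  case 0
  show ?case by (simp add: monomial_def)
next
  case (Suc e)
  then show ?case
    by (simp add: var_def monomial_def mult_single single_add [symmetric])
qed

definition monomial_ideal :: "('n, 'k::field) mpoly set \<Rightarrow> bool" where
  "monomial_ideal I \<longleftrightarrow> (\<exists>S. I = ideal.span (monomial ` S))"

definition minimal_monomial_generators ::
    "('n, 'k::field) mpoly set \<Rightarrow> ('n, 'k) mpoly set \<Rightarrow> bool" where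
  "minimal_monomial_generators I G \<longleftrightarrow>
     G \<subseteq> range monomial \<and> ideal.span G = I \<and> (\<forall>G'. G' \<subset> G \<longrightarrow> ideal.span G' \<noteq> I)"

text \<open>Only meaningful for monomial ideals, for which the minimal generating set of monomials
  exists and is unique.\<close>

definition Min_gens :: "('n, 'k::field) mpoly set \<Rightarrow> ('n, 'k) mpoly set" where
  "Min_gens I = (THE G. minimal_monomial_generators I G)"

definition generic :: "('n, 'k::field) mpoly set \<Rightarrow> bool" where
  "generic I \<longleftrightarrow>
     (\<forall>\<alpha> \<beta>. monomial \<alpha> \<in> Min_gens I \<longrightarrow> monomial \<beta> \<in> Min_gens I \<longrightarrow> \<alpha> \<noteq> \<beta> \<longrightarrow>
        (\<forall>i. Poly_Mapping.lookup \<alpha> i \<noteq> 0 \<longrightarrow>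
          Poly_Mapping.lookup \<alpha> i \<noteq> Poly_Mapping.lookup \<beta> i))"

text \<open>Decided at the largest index where the exponents differ. (The order instance on
  \<open>\<Rightarrow>\<^sub>0\<close> decides at the smallest one and is therefore not used.)\<close>

definition lex_less :: "('n::linorder) expo \<Rightarrow> 'n expo \<Rightarrow> bool" where
  "lex_less \<alpha> \<beta> \<longleftrightarrow>
     (\<exists>k. (\<forall>j>k. Poly_Mapping.lookup \<alpha> j = Poly_Mapping.lookup \<beta> j) \<and>
        Poly_Mapping.lookup \<alpha> k < Poly_Mapping.lookup \<beta> k)"

definition irr_ideal :: "'n expo \<Rightarrow> ('n, 'k::field) mpoly set" where
  "irr_ideal \<beta> = ideal.span (range (\<lambda>i. var i ^ Poly_Mapping.lookup \<beta> i))"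

definition irredundant_decomposition ::
    "('n, 'k::field) mpoly set \<Rightarrow> 'n expo set \<Rightarrow> bool" where
  "irredundant_decomposition I B \<longleftrightarrow>
     finite B \<and> (\<forall>\<beta>\<in>B. \<forall>i. Poly_Mapping.lookup \<beta> i > 0) \<and>
     I = (\<Inter>\<beta>\<in>B. irr_ideal \<beta>) \<and>
     (\<forall>\<beta>\<in>B. I \<noteq> (\<Inter>\<gamma>\<in>B - {\<beta>}. irr_ideal \<gamma>))"

text \<open>Only meaningful for Artinian monomial ideals (those containing a power of each variable),
  for which the irredundant decomposition exists and is unique.\<close>

definition Irr :: "('n, 'k::field) mpoly set \<Rightarrow> 'n expo set" where
  "Irr I = (THE B. irredundant_decomposition I B)"

end

theory Submission
  imports Defs "HOL-Library.FuncSet"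
begin

text \<open>
  The components of an Artinian monomial ideal correspond to the maximal exponents (for
  divisibility) outside the ideal, with all entries raised by one. Let \<open>g = \<alpha>\<^sub>p\<close> and let \<open>m\<close> be the
  largest index with \<open>g\<^sub>m > 0\<close>. By genericity and the lex order, every other \<open>\<alpha>\<^sub>k\<close> has a strictly
  smaller \<open>m\<close>-th entry than \<open>g\<close>. A maximal exponent outside the smaller ideal which is not a multiple
  of \<open>g\<close> remains maximal for \<open>I\<close>. If it is a multiple of \<open>g\<close>, then its \<open>m\<close>-th entry has to be
  \<open>c\<^sub>m - 1\<close>, and replacing this entry by \<open>g\<^sub>m - 1\<close> gives a maximal exponent for \<open>I\<close> which was not
  maximal before.
\<close>

section \<open>Monomial ideals as sets of exponents\<close>

definition polys_on :: "('n \<Rightarrow> nat) set \<Rightarrow> ('n, 'k::field) mpoly set" where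
  "polys_on A = {f. \<forall>\<gamma>\<in>Poly_Mapping.keys f. Poly_Mapping.lookup \<gamma> \<in> A}"

text \<open>Divisibility of monomials is the pointwise order on functions, whereas the order
  instance on \<open>\<Rightarrow>\<^sub>0\<close> is lexicographic; hence the values are plain
  functions and the elements of \<open>S\<close> are compared through \<open>lookup\<close>.\<close>

definition multiples :: "'n expo set \<Rightarrow> ('n \<Rightarrow> nat) set" where
  "multiples S = {\<gamma>. \<exists>s\<in>S. Poly_Mapping.lookup s \<le> \<gamma>}"

definition maximals :: "'a::order set \<Rightarrow> 'a set" where
  "maximals D = {x\<in>D. \<forall>y\<in>D. x \<le> y \<longrightarrow> x = y}"

definition minimal_exponents :: "('n, 'k::field) mpoly set \<Rightarrow> 'n expo set" where
  "minimal_exponents I = {\<gamma>. monomial \<gamma> \<in> I \<and>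
     (\<forall>\<delta>. monomial \<delta> \<in> I \<longrightarrow> Poly_Mapping.lookup \<delta> \<le> Poly_Mapping.lookup \<gamma> \<longrightarrow> \<delta> = \<gamma>)}"

lemma lookup_single_le_iff:
  "Poly_Mapping.lookup (Poly_Mapping.single i b) \<le> \<gamma> \<longleftrightarrow> b \<le> \<gamma> i"
  for b :: nat
  by (auto simp: le_fun_def lookup_single when_def)

lemma lookup_surj:
  fixes \<gamma> :: "'n::finite \<Rightarrow> nat"
  obtains \<delta> where "Poly_Mapping.lookup \<delta> = \<gamma>"
  by (rule that[of "Abs_poly_mapping \<gamma>"]) simp

lemma monomial_in_polys_on_iff [simp]:
  "monomial \<gamma> \<in> polys_on A \<longleftrightarrow> Poly_Mapping.lookup \<gamma> \<in> A"
  by (simp add: polys_on_def monomial_def)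

lemma inj_monomial: "inj monomial"
  by (metis injI monomial_in_polys_on_iff poly_mapping_eqI singleton_iff)

text \<open>\<open>A\<close> can be read off from the monomials in \<open>polys_on A\<close>, since
  over a finite index type every function is the \<open>lookup\<close> of an exponent.\<close>

lemma polys_on_eq_iff:
  fixes A A' :: "('n::finite \<Rightarrow> nat) set"
  shows "(polys_on A :: ('n, 'k::field) mpoly set) = polys_on A' \<longleftrightarrow> A = A'"
proof
  assume eq: "(polys_on A :: ('n, 'k) mpoly set) = polys_on A'"
  show "A = A'"
  proof (rule set_eqI)
    fix \<gamma> :: "'n \<Rightarrow> nat"
    obtain \<delta> where "Poly_Mapping.lookup \<delta> = \<gamma>" by (rule lookup_surj)
    with eq show "\<gamma> \<in> A \<longleftrightarrow> \<gamma> \<in> A'"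
      using monomial_in_polys_on_iff[where 'b='k] by metis
  qed
qed simp

text \<open>The right-hand side is an ideal because the exponents of \<open>h * f\<close> are sums
  of an exponent of \<open>h\<close> and one of \<open>f\<close>. Conversely, a polynomial is the
  sum of its terms, and here each term is a multiple of a generator.\<close>

lemma span_monomials:
  "ideal.span (monomial ` S) = (polys_on (multiples S) :: ('n, 'k::field) mpoly set)"
proof
  have "ideal.subspace (polys_on (multiples S) :: ('n, 'k) mpoly set)"
  proof (rule ideal.subspaceI)
    fix f g :: "('n, 'k) mpoly"
    assume "f \<in> polys_on (multiples S)" "g \<in> polys_on (multiples S)"
    then show "f + g \<in> polys_on (multiples S)"
      using Poly_Mapping.keys_add[of f g] by (auto simp: polys_on_def)
  next
    fix h f :: "('n, 'k) mpoly"
    assume f: "f \<in> polys_on (multiples S)"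
    have "Poly_Mapping.lookup (a + b) \<in> multiples S" if "b \<in> Poly_Mapping.keys f" for a b
    proof -
      obtain s where s: "s \<in> S" "Poly_Mapping.lookup s \<le> Poly_Mapping.lookup b"
        using f \<open>b \<in> Poly_Mapping.keys f\<close> by (auto simp: polys_on_def multiples_def)
      then have "Poly_Mapping.lookup s \<le> Poly_Mapping.lookup (a + b)"
        by (auto simp: le_fun_def lookup_add intro: trans_le_add2)
      with s show ?thesis by (auto simp: multiples_def)
    qed
    then show "h * f \<in> polys_on (multiples S)"
      using keys_mult[of h f] by (fastforce simp: polys_on_def)
  qed (simp add: polys_on_def)
  then show "ideal.span (monomial ` S) \<subseteq> (polys_on (multiples S) :: ('n, 'k) mpoly set)"
    by (intro ideal.span_minimal) (auto simp: multiples_def)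
next
  show "polys_on (multiples S) \<subseteq> (ideal.span (monomial ` S) :: ('n, 'k) mpoly set)"
  proof
    fix f :: "('n, 'k) mpoly"
    assume f: "f \<in> polys_on (multiples S)"
    have "Poly_Mapping.single \<gamma> (Poly_Mapping.lookup f \<gamma>) \<in> ideal.span (monomial ` S)"
      if "\<gamma> \<in> Poly_Mapping.keys f" for \<gamma>
    proof -
      obtain s where s: "s \<in> S" "Poly_Mapping.lookup s \<le> Poly_Mapping.lookup \<gamma>"
        using f \<open>\<gamma> \<in> Poly_Mapping.keys f\<close> by (auto simp: polys_on_def multiples_def)
      \<comment> \<open>The entrywise subtraction is truncated, so this uses that \<open>s\<close>
        divides \<gamma>.\<close>
      have "\<gamma> = (\<gamma> - s) + s"
        using s(2) by (intro poly_mapping_eqI) (simp add: lookup_add lookup_minus le_fun_def)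
      then have "Poly_Mapping.single \<gamma> (Poly_Mapping.lookup f \<gamma>) =
          Poly_Mapping.single (\<gamma> - s) (Poly_Mapping.lookup f \<gamma>) * monomial s"
        by (simp add: monomial_def mult_single)
      then show ?thesis
        using s(1) by (simp add: ideal.span_scale ideal.span_base)
    qed
    then have "(\<Sum>\<gamma>\<in>Poly_Mapping.keys f. Poly_Mapping.single \<gamma> (Poly_Mapping.lookup f \<gamma>))
        \<in> ideal.span (monomial ` S)"
      by (intro ideal.span_sum)
    moreover have "(\<Sum>\<gamma>\<in>Poly_Mapping.keys f. Poly_Mapping.single \<gamma> (Poly_Mapping.lookup f \<gamma>)) = f"
      by (intro poly_mapping_eqI)
        (auto simp: lookup_sum lookup_single when_def in_keys_iff)
    ultimately show "f \<in> ideal.span (monomial ` S)"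
      by simp
  qed
qed

section \<open>Minimal monomial generators\<close>

lemma span_minimal_exponents:
  fixes I :: "('n::finite, 'k::field) mpoly set"
  assumes "monomial_ideal I"
  shows "ideal.span (monomial ` minimal_exponents I) = I"
proof -
  obtain S where I: "I = polys_on (multiples S)"
    using assms unfolding monomial_ideal_def span_monomials by blast
  have ex: "\<exists>\<delta>\<in>minimal_exponents I. Poly_Mapping.lookup \<delta> \<le> Poly_Mapping.lookup \<gamma>"
    if "monomial \<gamma> \<in> I" for \<gamma>
    using that
  \<comment> \<open>Descent on the total degree: a proper divisor has smaller degree.\<close>
  proof (induction "sum (Poly_Mapping.lookup \<gamma>) UNIV" arbitrary: \<gamma> rule: less_induct)
    case less
    show ?case
    proof (cases "\<gamma> \<in> minimal_exponents I")
      case False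
      then obtain \<delta> where \<delta>: "monomial \<delta> \<in> I" "\<delta> \<noteq> \<gamma>"
          "Poly_Mapping.lookup \<delta> \<le> Poly_Mapping.lookup \<gamma>"
        using less.prems by (auto simp: minimal_exponents_def)
      then obtain i where "Poly_Mapping.lookup \<delta> i \<noteq> Poly_Mapping.lookup \<gamma> i"
        by (meson poly_mapping_eqI)
      then have "sum (Poly_Mapping.lookup \<delta>) UNIV < sum (Poly_Mapping.lookup \<gamma>) UNIV"
        using \<delta>(3) by (intro sum_strict_mono_ex1) (auto simp: le_fun_def intro!: le_neq_trans)
      with less.hyps \<delta> show ?thesis by (meson order_trans)
    qed auto
  qed
  have "multiples (minimal_exponents I) = multiples S"
  proof (intro set_eqI iffI)
    fix \<gamma> assume "\<gamma> \<in> multiples (minimal_exponents I)"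
    then show "\<gamma> \<in> multiples S"
      by (auto simp: multiples_def minimal_exponents_def I)
  next
    fix \<gamma> assume "\<gamma> \<in> multiples S"
    then obtain s where s: "s \<in> S" "Poly_Mapping.lookup s \<le> \<gamma>"
      by (auto simp: multiples_def)
    then have "monomial s \<in> I"
      by (auto simp: I multiples_def)
    with ex s show "\<gamma> \<in> multiples (minimal_exponents I)"
      unfolding multiples_def by (blast intro: order_trans)
  qed
  then show ?thesis by (simp add: span_monomials I)
qed

text \<open>Each monomial of the ideal is divisible by one from \<open>G\<close>, which again lies
  in the ideal; if the former is minimal, the two coincide.\<close>

lemma minimal_exponents_subset:
  fixes I :: "('n, 'k::field) mpoly set"
  assumes "G \<subseteq> range monomial" "ideal.span G = I"
  shows "monomial ` minimal_exponents I \<subseteq> G"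
proof
  fix f :: "('n, 'k) mpoly"
  assume "f \<in> monomial ` minimal_exponents I"
  then obtain \<gamma> where f: "f = monomial \<gamma>" and \<gamma>: "\<gamma> \<in> minimal_exponents I" by blast
  obtain S where G: "G = monomial ` S"
    using assms(1) by (auto simp: subset_image_iff)
  then have I: "I = polys_on (multiples S)"
    using assms(2) span_monomials by metis
  obtain s where s: "s \<in> S" "Poly_Mapping.lookup s \<le> Poly_Mapping.lookup \<gamma>"
    using \<gamma> by (auto simp: minimal_exponents_def I multiples_def)
  then have "monomial s \<in> I"
    by (auto simp: I multiples_def)
  with \<gamma> s have "s = \<gamma>"
    by (auto simp: minimal_exponents_def)
  with s show "f \<in> G" by (simp add: f G)
qed

text \<open>The minimal exponents give the least generating set of monomials. So none of its proper
  subsets generates, and every irredundant generating set equals it, which settles the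
  \<open>THE\<close>.\<close>

lemma Min_gens_eq:
  fixes I :: "('n::finite, 'k::field) mpoly set"
  assumes "monomial_ideal I"
  shows "Min_gens I = monomial ` minimal_exponents I"
  unfolding Min_gens_def
proof (rule the_equality)
  show "minimal_monomial_generators I (monomial ` minimal_exponents I)"
    unfolding minimal_monomial_generators_def
    using span_minimal_exponents[OF assms] minimal_exponents_subset[of _ I] by blast
next
  fix G assume "minimal_monomial_generators I G"
  then show "G = monomial ` minimal_exponents I"
    unfolding minimal_monomial_generators_def
    using span_minimal_exponents[OF assms] minimal_exponents_subset[of G I] by blast
qed

section \<open>Irreducible components and maximal exponents outside the ideal\<close>

definition box :: "'n expo \<Rightarrow> ('n \<Rightarrow> nat) set" where
  "box \<beta> = {\<gamma>. \<forall>i. \<gamma> i < Poly_Mapping.lookup \<beta> i}"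

lemma irr_ideal_eq: "irr_ideal \<beta> = (polys_on (- box \<beta>) :: ('n, 'k::field) mpoly set)"
proof -
  have "range (\<lambda>i. var i ^ Poly_Mapping.lookup \<beta> i) =
      (monomial ` range (\<lambda>i. Poly_Mapping.single i (Poly_Mapping.lookup \<beta> i)) :: ('n, 'k) mpoly set)"
    by (simp add: var_power image_image)
  moreover have "multiples (range (\<lambda>i. Poly_Mapping.single i (Poly_Mapping.lookup \<beta> i))) = - box \<beta>"
    by (auto simp: multiples_def lookup_single_le_iff box_def simp flip: not_less)
  ultimately show ?thesis
    by (simp add: irr_ideal_def span_monomials)
qed

text \<open>On complements, an intersection of irreducible ideals becomes a union of boxes, so a
  decomposition is a covering of the exponents outside the ideal.\<close>

lemma INT_irr_ideal: "(\<Inter>\<beta>\<in>B. irr_ideal \<beta>) = polys_on (- (\<Union>\<beta>\<in>B. box \<beta>))"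
  by (auto simp: irr_ideal_eq polys_on_def)

lemma irredundant_decomposition_iff:
  fixes A :: "('n::finite \<Rightarrow> nat) set"
  shows "irredundant_decomposition (polys_on A :: ('n, 'k::field) mpoly set) B \<longleftrightarrow>
    finite B \<and> (\<forall>\<beta>\<in>B. \<forall>i. Poly_Mapping.lookup \<beta> i > 0) \<and> - A = (\<Union>\<beta>\<in>B. box \<beta>) \<and>
    (\<forall>\<beta>\<in>B. - A \<noteq> (\<Union>\<gamma>\<in>B - {\<beta>}. box \<gamma>))"
proof -
  have compl: "A = - X \<longleftrightarrow> - A = X" for X by blast
  then show ?thesis
    unfolding irredundant_decomposition_def INT_irr_ideal polys_on_eq_iff by (simp only: compl)
qed

lemma finite_below_maximal:
  assumes "finite D" "x \<in> D"
  obtains y where "y \<in> maximals D" "x \<le> y"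
  using finite_has_maximal2[OF assms] by (auto simp: maximals_def)

text \<open>A box with positive side lengths is the set of all exponents below its top corner. A
  finite down-closed set has exactly one irredundant covering by such principal down-sets, given by
  its maximal elements.\<close>

lemma irredundant_decomposition_polys_on:
  fixes A :: "('n::finite \<Rightarrow> nat) set"
  assumes fin: "finite (- A)" and up: "\<And>\<gamma> \<delta>. \<gamma> \<in> A \<Longrightarrow> \<gamma> \<le> \<delta> \<Longrightarrow> \<delta> \<in> A"
  shows "irredundant_decomposition (polys_on A :: ('n, 'k::field) mpoly set) B \<longleftrightarrow>
    B = {\<beta>. \<exists>\<gamma>\<in>maximals (- A). Poly_Mapping.lookup \<beta> = Suc \<circ> \<gamma>}" (is "_ \<longleftrightarrow> B = ?W")
proof
  have box_Suc: "\<delta> \<in> box \<beta> \<longleftrightarrow> \<delta> \<le> \<gamma>"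
    if "Poly_Mapping.lookup \<beta> = Suc \<circ> \<gamma>" for \<beta> :: "'n expo" and \<gamma> \<delta>
    using that by (simp add: box_def le_fun_def less_Suc_eq_le)
  {
    assume "irredundant_decomposition (polys_on A :: ('n, 'k) mpoly set) B"
    then have pos: "\<And>\<beta> i. \<beta> \<in> B \<Longrightarrow> Poly_Mapping.lookup \<beta> i > 0"
      and un: "- A = (\<Union>\<beta>\<in>B. box \<beta>)" and irr: "\<And>\<beta>. \<beta> \<in> B \<Longrightarrow> - A \<noteq> (\<Union>\<gamma>\<in>B - {\<beta>}. box \<gamma>)"
      unfolding irredundant_decomposition_iff by blast+
    \<comment> \<open>The greatest element of the box; the subtraction is exact on \<open>B\<close>,
      where all entries are positive.\<close>
    define corner where "corner \<beta> = (\<lambda>i. Poly_Mapping.lookup \<beta> i - 1)" for \<beta> :: "'n expo"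
    have corner: "Poly_Mapping.lookup \<beta> = Suc \<circ> corner \<beta>" if "\<beta> \<in> B" for \<beta>
      using pos[OF that] by (auto simp: corner_def)
    have corner_notin: "corner \<beta> \<in> - A" if "\<beta> \<in> B" for \<beta>
      using that box_Suc[OF corner[OF that]] unfolding un by blast
    have maximal: "corner \<beta> \<in> maximals (- A)" if \<beta>: "\<beta> \<in> B" for \<beta>
    proof -
      have "corner \<beta> = \<delta>" if \<delta>: "\<delta> \<in> - A" "corner \<beta> \<le> \<delta>" for \<delta>
      proof -
        obtain \<beta>' where \<beta>': "\<beta>' \<in> B" "\<delta> \<in> box \<beta>'"
          using \<delta>(1) unfolding un by blast
        have le: "\<delta> \<le> corner \<beta>'"
          using box_Suc[OF corner] \<beta>' by blast
        \<comment> \<open>The box covering \<delta> swallows that of \<beta>, which would be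
          redundant unless the two are the same.\<close>
        then have "box \<beta> \<subseteq> box \<beta>'"
          using box_Suc[OF corner] \<beta> \<beta>'(1) \<delta>(2) by (meson order_trans subsetI)
        then have "\<beta>' = \<beta>"
          using irr[OF \<beta>] \<beta> \<beta>'(1) unfolding un by blast
        with le \<delta>(2) show ?thesis by simp
      qed
      then show ?thesis
        using corner_notin[OF \<beta>] by (auto simp: maximals_def)
    qed
    show "B = ?W"
    proof (intro set_eqI iffI)
      fix \<beta> assume "\<beta> \<in> B"
      then show "\<beta> \<in> ?W" using corner maximal by blast
    next
      fix \<beta> assume "\<beta> \<in> ?W"
      then obtain \<gamma> where \<gamma>: "\<gamma> \<in> maximals (- A)" "Poly_Mapping.lookup \<beta> = Suc \<circ> \<gamma>"
        by blast
      then obtain \<beta>' where \<beta>': "\<beta>' \<in> B" "\<gamma> \<in> box \<beta>'"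
        using un by (auto simp: maximals_def)
      then have "\<gamma> \<le> corner \<beta>'"
        using box_Suc[OF corner] by blast
      then have "\<gamma> = corner \<beta>'"
        using \<gamma>(1) corner_notin[OF \<beta>'(1)] by (auto simp: maximals_def)
      then have "\<beta> = \<beta>'"
        using \<gamma>(2) corner[OF \<beta>'(1)] by (metis poly_mapping_eqI)
      with \<beta>' show "\<beta> \<in> B" by simp
    qed
  }
  {
    assume B: "B = ?W"
    have "Poly_Mapping.lookup ` B \<subseteq> (\<lambda>\<gamma>. Suc \<circ> \<gamma>) ` (- A)"
      unfolding B by (auto simp: maximals_def)
    moreover have "inj_on Poly_Mapping.lookup B"
      by (simp add: inj_on_def poly_mapping_eqI)
    ultimately have "finite B"
      using fin by (meson finite_imageD finite_imageI finite_subset)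
    moreover have "\<forall>\<beta>\<in>B. \<forall>i. Poly_Mapping.lookup \<beta> i > 0"
      unfolding B by auto
    moreover have "- A = (\<Union>\<beta>\<in>B. box \<beta>)"
    proof (intro set_eqI iffI)
      fix \<delta> assume "\<delta> \<in> - A"
      then obtain \<gamma> where \<gamma>: "\<gamma> \<in> maximals (- A)" "\<delta> \<le> \<gamma>"
        using finite_below_maximal[OF fin] by blast
      obtain \<beta> where "Poly_Mapping.lookup \<beta> = Suc \<circ> \<gamma>" by (rule lookup_surj)
      with \<gamma> box_Suc show "\<delta> \<in> (\<Union>\<beta>\<in>B. box \<beta>)" unfolding B by blast
    next
      fix \<delta> assume "\<delta> \<in> (\<Union>\<beta>\<in>B. box \<beta>)"
      then obtain \<gamma> where "\<gamma> \<in> - A" "\<delta> \<le> \<gamma>"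
        unfolding B using box_Suc by (auto simp: maximals_def)
      with up show "\<delta> \<in> - A" by blast
    qed
    \<comment> \<open>A maximal exponent lies in no other box, since it is below no other maximal
      exponent.\<close>
    moreover have "- A \<noteq> (\<Union>\<beta>'\<in>B - {\<beta>}. box \<beta>')" if "\<beta> \<in> B" for \<beta>
    proof
      assume eq: "- A = (\<Union>\<beta>'\<in>B - {\<beta>}. box \<beta>')"
      obtain \<gamma> where \<gamma>: "\<gamma> \<in> maximals (- A)" "Poly_Mapping.lookup \<beta> = Suc \<circ> \<gamma>"
        using \<open>\<beta> \<in> B\<close> unfolding B by blast
      then obtain \<beta>' where \<beta>': "\<beta>' \<in> B" "\<beta>' \<noteq> \<beta>" "\<gamma> \<in> box \<beta>'"
        using eq unfolding maximals_def by blast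
      then obtain \<gamma>' where \<gamma>': "\<gamma>' \<in> maximals (- A)" "Poly_Mapping.lookup \<beta>' = Suc \<circ> \<gamma>'"
        unfolding B by blast
      then have "\<gamma> = \<gamma>'"
        using \<gamma>(1) \<beta>'(3) box_Suc unfolding maximals_def by blast
      with \<gamma>(2) \<gamma>'(2) \<beta>'(2) show False by (metis poly_mapping_eqI)
    qed
    ultimately show "irredundant_decomposition (polys_on A :: ('n, 'k) mpoly set) B"
      by (simp add: irredundant_decomposition_iff)
  }
qed

text \<open>Uniqueness of the decomposition evaluates the \<open>THE\<close> in \<open>Irr\<close>;
  lowering all entries by one then matches components with maximal exponents.\<close>

lemma card_Irr_polys_on:
  fixes A :: "('n::finite \<Rightarrow> nat) set"
  assumes "finite (- A)" and "\<And>\<gamma> \<delta>. \<gamma> \<in> A \<Longrightarrow> \<gamma> \<le> \<delta> \<Longrightarrow> \<delta> \<in> A"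
  shows "card (Irr (polys_on A :: ('n, 'k::field) mpoly set)) = card (maximals (- A))"
proof -
  let ?W = "{\<beta>. \<exists>\<gamma>\<in>maximals (- A). Poly_Mapping.lookup \<beta> = Suc \<circ> \<gamma>}"
  have "irredundant_decomposition (polys_on A :: ('n, 'k) mpoly set) B \<longleftrightarrow> B = ?W" for B
    using assms by (rule irredundant_decomposition_polys_on)
  then have "Irr (polys_on A :: ('n, 'k) mpoly set) = ?W"
    by (simp add: Irr_def)
  moreover have "bij_betw (\<lambda>\<beta> i. Poly_Mapping.lookup \<beta> i - 1) ?W (maximals (- A))"
  proof (rule bij_betwI')
    fix \<beta> \<beta>' assume "\<beta> \<in> ?W" "\<beta>' \<in> ?W"
    then obtain \<gamma> \<gamma>' where "Poly_Mapping.lookup \<beta> = Suc \<circ> \<gamma>" "Poly_Mapping.lookup \<beta>' = Suc \<circ> \<gamma>'"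
      by blast
    then show "(\<lambda>i. Poly_Mapping.lookup \<beta> i - 1) = (\<lambda>i. Poly_Mapping.lookup \<beta>' i - 1) \<longleftrightarrow> \<beta> = \<beta>'"
      by (auto simp: fun_eq_iff intro!: poly_mapping_eqI)
  next
    fix \<gamma> assume "\<gamma> \<in> maximals (- A)"
    moreover obtain \<beta> where "Poly_Mapping.lookup \<beta> = Suc \<circ> \<gamma>" by (rule lookup_surj)
    ultimately show "\<exists>\<beta>\<in>?W. \<gamma> = (\<lambda>i. Poly_Mapping.lookup \<beta> i - 1)"
      by (intro bexI[of _ \<beta>]) auto
  qed auto
  ultimately show ?thesis by (simp add: bij_betw_same_card)
qed

section \<open>Artinian generating sets and the effect of one more generator\<close>

lemma finite_standard_exponents:
  fixes c :: "'n::finite \<Rightarrow> nat"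
  assumes "range (\<lambda>i. Poly_Mapping.single i (c i)) \<subseteq> S"
  shows "finite (- multiples S)"
proof (rule finite_subset)
  show "- multiples S \<subseteq> {\<gamma>. \<forall>i. \<gamma> i \<in> {..<c i}}"
    using assms by (fastforce simp: multiples_def image_subset_iff lookup_single_le_iff not_less[symmetric])
  show "finite {\<gamma>. \<forall>i. \<gamma> i \<in> {..<c i}}"
    using finite_PiE[of UNIV "\<lambda>i. {..<c i}"] by (simp add: PiE_UNIV_domain Pi_def)
qed

lemma card_Irr_span:
  fixes c :: "'n::finite \<Rightarrow> nat"
  assumes "range (\<lambda>i. Poly_Mapping.single i (c i)) \<subseteq> S"
  shows "card (Irr (ideal.span (monomial ` S) :: ('n, 'k::field) mpoly set)) =
    card (maximals (- multiples S))"
  unfolding span_monomials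
  by (rule card_Irr_polys_on[OF finite_standard_exponents[OF assms]])
    (auto simp: multiples_def intro: order_trans)

text \<open>By \<open>small\<close>, elements of \<open>F\<close> have \<open>m\<close>-th entry at
  most \<open>lookup g m - 1\<close>. So changing the \<open>m\<close>-th entry of an exponent among
  values from there upwards does not affect which elements of \<open>F\<close> divide it.\<close>

lemma card_maximals_add_generator:
  fixes c :: "'n::finite \<Rightarrow> nat" and g :: "'n expo" and F :: "'n expo set" and m :: 'n
  defines "E \<equiv> range (\<lambda>i. Poly_Mapping.single i (c i)) \<union> F"
  assumes small: "\<And>\<alpha>. \<alpha> \<in> F \<Longrightarrow> Poly_Mapping.lookup \<alpha> m < Poly_Mapping.lookup g m"
    and g_pos: "Poly_Mapping.lookup g m > 0"
  shows "card (maximals (- multiples E)) \<le> card (maximals (- multiples (insert g E)))"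
proof -
  let ?M = "maximals (- multiples E)" and ?M' = "maximals (- multiples (insert g E))"
  let ?g = "Poly_Mapping.lookup g"
  have cE: "\<gamma> \<in> multiples E \<longleftrightarrow> (\<exists>i. c i \<le> \<gamma> i) \<or> (\<exists>\<alpha>\<in>F. Poly_Mapping.lookup \<alpha> \<le> \<gamma>)" for \<gamma>
    by (simp add: E_def multiples_def bex_Un lookup_single_le_iff)
  have cE': "\<gamma> \<in> multiples (insert g E) \<longleftrightarrow> ?g \<le> \<gamma> \<or> \<gamma> \<in> multiples E" for \<gamma>
    by (auto simp: multiples_def)
  have fin: "finite (- multiples E)" "finite (- multiples (insert g E))"
    by (rule finite_standard_exponents[of c]; auto simp: E_def)+
  \<comment> \<open>\<open>?g m - 1\<close> is the largest \<open>m\<close>-th entry that avoids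
    divisibility by \<open>g\<close>; \<open>g_pos\<close> makes the subtraction genuine.\<close>
  define \<phi> where "\<phi> \<gamma> = (if ?g \<le> \<gamma> then \<gamma>(m := ?g m - 1) else \<gamma>)" for \<gamma>
  \<comment> \<open>Raising the \<open>m\<close>-th entry must enter the ideal. No element of
    \<open>F\<close> can cause this, so a pure power does, and it is that of the raised
    variable.\<close>
  have top: "\<gamma> m = c m - 1" if \<gamma>: "\<gamma> \<in> ?M" "?g \<le> \<gamma>" for \<gamma>
  proof -
    have notin: "\<gamma> \<notin> multiples E"
      using \<gamma>(1) by (auto simp: maximals_def)
    have "\<gamma> \<noteq> \<gamma>(m := Suc (\<gamma> m))"
      by (metis fun_upd_same n_not_Suc_n)
    moreover have "\<gamma> \<le> \<gamma>(m := Suc (\<gamma> m))"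
      by (simp add: le_fun_def)
    ultimately have "\<gamma>(m := Suc (\<gamma> m)) \<in> multiples E"
      using \<gamma>(1) unfolding maximals_def by blast
    moreover have "\<not> Poly_Mapping.lookup \<alpha> \<le> \<gamma>(m := Suc (\<gamma> m))" if "\<alpha> \<in> F" for \<alpha>
    proof
      assume le: "Poly_Mapping.lookup \<alpha> \<le> \<gamma>(m := Suc (\<gamma> m))"
      have "Poly_Mapping.lookup \<alpha> i \<le> \<gamma> i" for i
      proof (cases "i = m")
        case True
        then show ?thesis
          using small[OF that] le_funD[OF \<gamma>(2), of m] by simp
      next
        case False
        then show ?thesis using le_funD[OF le, of i] by simp
      qed
      then show False
        using notin that cE by (auto simp: le_fun_def)
    qed
    ultimately obtain i where i: "c i \<le> (\<gamma>(m := Suc (\<gamma> m))) i"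
      using cE by blast
    moreover have "\<gamma> j < c j" for j
      using notin cE by (meson not_less)
    ultimately show ?thesis
      by (metis Suc_leI diff_Suc_1 fun_upd_apply le_antisym not_less)
  qed
  have new: "\<phi> \<gamma> \<in> ?M'" if \<gamma>: "\<gamma> \<in> ?M" for \<gamma>
  proof (cases "?g \<le> \<gamma>")
    \<comment> \<open>The complement only shrinks when \<open>g\<close> is added, so a maximal
      element that stays in it remains maximal.\<close>
    case False
    then show ?thesis
      using \<gamma> by (auto simp: \<phi>_def maximals_def cE')
  next
    case True
    have notin: "\<gamma> \<notin> multiples E"
      using \<gamma> by (auto simp: maximals_def)
    have "?g m - 1 \<le> \<gamma> m"
      using le_funD[OF True, of m] by simp
    then have below: "\<phi> \<gamma> \<le> \<gamma>"
      by (auto simp: \<phi>_def le_fun_def)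
    have "\<not> ?g \<le> \<phi> \<gamma>"
      using g_pos True by (auto simp: \<phi>_def le_fun_def intro!: exI[of _ m])
    moreover have "\<phi> \<gamma> \<notin> multiples E"
      using notin below unfolding multiples_def by (blast intro: order_trans)
    moreover have "\<phi> \<gamma> = \<delta>" if \<delta>: "\<delta> \<notin> multiples (insert g E)" "\<phi> \<gamma> \<le> \<delta>" for \<delta>
    proof -
      have \<delta>_ge: "\<gamma> i \<le> \<delta> i" if "i \<noteq> m" for i
        using le_funD[OF \<delta>(2), of i] that True by (simp add: \<phi>_def)
      \<comment> \<open>Away from \<open>m\<close>, \<delta> dominates \<gamma> and hence
        \<open>g\<close>, so only the \<open>m\<close>-th entry can keep \<open>g\<close> from
        dividing \<delta>.\<close>
      have "\<delta> m < ?g m"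
      proof (rule ccontr)
        assume "\<not> \<delta> m < ?g m"
        then have "?g \<le> \<delta>"
          using \<delta>_ge le_funD[OF True] by (metis le_funI not_less order_trans)
        with \<delta>(1) show False by (simp add: cE')
      qed
      then have \<delta>m: "\<delta> m = ?g m - 1"
        using le_funD[OF \<delta>(2), of m] True by (simp add: \<phi>_def)
      \<comment> \<open>Restoring the old \<open>m\<close>-th entry gives an exponent above \<gamma>
        that is still outside the smaller ideal; maximality of \<gamma> then forces
        equality.\<close>
      have "\<delta>(m := \<gamma> m) \<notin> multiples E"
      proof
        assume "\<delta>(m := \<gamma> m) \<in> multiples E"
        then consider i where "c i \<le> (\<delta>(m := \<gamma> m)) i"
          | \<alpha> where "\<alpha> \<in> F" "Poly_Mapping.lookup \<alpha> \<le> \<delta>(m := \<gamma> m)"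
          using cE by blast
        then show False
        proof cases
          case 1
          then show False
            using notin \<delta>(1) unfolding cE' cE by (metis fun_upd_apply)
        next
          case 2
          have "Poly_Mapping.lookup \<alpha> i \<le> \<delta> i" for i
            using small[OF 2(1)] \<delta>m le_funD[OF 2(2), of i] by (cases "i = m") auto
          then show False
            using \<delta>(1) 2(1) unfolding cE' cE by (auto simp: le_fun_def)
        qed
      qed
      moreover have "\<gamma> \<le> \<delta>(m := \<gamma> m)"
        using \<delta>_ge by (auto simp: le_fun_def)
      ultimately have "\<gamma> = \<delta>(m := \<gamma> m)"
        using \<gamma> by (auto simp: maximals_def)
      then have "\<gamma>(m := ?g m - 1) = \<delta>(m := ?g m - 1)"
        by (metis fun_upd_upd)
      then show ?thesis
        using \<delta>m True by (simp add: \<phi>_def fun_upd_idem)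
    qed
    ultimately show ?thesis
      by (simp add: maximals_def cE')
  qed
  \<comment> \<open>A moved exponent drops strictly below \<gamma>, so its image cannot collide with
    an exponent that \<phi> leaves fixed.\<close>
  have phi_notin: "\<phi> \<gamma> \<notin> ?M" if \<gamma>: "\<gamma> \<in> ?M" "?g \<le> \<gamma>" for \<gamma>
  proof
    assume "\<phi> \<gamma> \<in> ?M"
    moreover have less: "?g m - 1 < \<gamma> m"
      using le_funD[OF \<gamma>(2), of m] g_pos by simp
    then have "\<phi> \<gamma> \<le> \<gamma>"
      by (auto simp: \<phi>_def le_fun_def)
    moreover have "\<phi> \<gamma> m < \<gamma> m"
      using less \<gamma>(2) by (simp add: \<phi>_def)
    ultimately show False
      using \<gamma>(1) by (auto simp: maximals_def)
  qed
  have "inj_on \<phi> ?M"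
  proof (rule inj_onI)
    fix \<gamma> \<delta> assume *: "\<gamma> \<in> ?M" "\<delta> \<in> ?M" "\<phi> \<gamma> = \<phi> \<delta>"
    show "\<gamma> = \<delta>"
    proof (cases "?g \<le> \<gamma> \<longleftrightarrow> ?g \<le> \<delta>")
      case False
      then show ?thesis
        using * phi_notin by (metis \<phi>_def)
    next
      case True
      show ?thesis
      proof (cases "?g \<le> \<gamma>")
        case False
        then show ?thesis using True * by (simp add: \<phi>_def)
      next
        case ge: True
        \<comment> \<open>Only the \<open>m\<close>-th entry was overwritten, and \<open>top\<close>
          recovers its former value.\<close>
        then have "\<gamma> m = c m - 1" "\<delta> m = c m - 1"
          using True *(1,2) top by blast+
        then have "(\<phi> \<gamma>)(m := c m - 1) = \<gamma>" "(\<phi> \<delta>)(m := c m - 1) = \<delta>"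
          using True ge by (simp_all add: \<phi>_def fun_upd_idem)
        with * show ?thesis by simp
      qed
    qed
  qed
  moreover have "finite ?M'"
    using fin(2) by (rule rev_finite_subset) (auto simp: maximals_def)
  ultimately show ?thesis
    using new by (intro card_inj_on_le[of \<phi>]) auto
qed

section \<open>Genericity and the lex order\<close>

theorem theorem11:
  fixes I :: "('n::{finite,linorder}, 'k::field) mpoly set"
    and c :: "'n \<Rightarrow> nat"
    and \<alpha> :: "nat \<Rightarrow> 'n expo"
    and p :: nat
  assumes "monomial_ideal I"
    and "generic I"
    and "\<And>i. c i > 0"
    and "p \<ge> 1"
    and "Min_gens I = range (\<lambda>i. var i ^ c i) \<union> (\<lambda>k. monomial (\<alpha> k)) ` {1..p}"
    and "range (\<lambda>i. var i ^ c i) \<inter> (\<lambda>k. monomial (\<alpha> k)) ` {1..p} = {}"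
    and "monotone_on {1..p} (<) lex_less \<alpha>"
  shows "card (Irr (ideal.span (range (\<lambda>i. var i ^ c i) \<union>
                      (\<lambda>k. monomial (\<alpha> k)) ` {1..p - 1}) :: ('n, 'k) mpoly set))
           \<le> card (Irr I)"
proof -
  let ?x = "range (\<lambda>i. Poly_Mapping.single i (c i))"
  let ?E = "?x \<union> \<alpha> ` {1..p - 1}"
  have gens: "range (\<lambda>i. var i ^ c i) \<union> (\<lambda>k. monomial (\<alpha> k)) ` K =
      (monomial ` (?x \<union> \<alpha> ` K) :: ('n, 'k) mpoly set)" for K
    by (simp add: var_power image_Un image_image)
  have "{1..p} = insert p {1..p - 1}"
    using \<open>p \<ge> 1\<close> by auto
  then have E: "?x \<union> \<alpha> ` {1..p} = insert (\<alpha> p) ?E"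
    by simp
  have Min: "Min_gens I = monomial ` insert (\<alpha> p) ?E"
    using assms(5) unfolding gens E .
  then have min_exp: "minimal_exponents I = insert (\<alpha> p) ?E"
    using Min_gens_eq[OF assms(1)] inj_image_eq_iff[OF inj_monomial] by metis
  have I: "I = ideal.span (monomial ` insert (\<alpha> p) ?E)"
    using span_minimal_exponents[OF assms(1)] unfolding min_exp by simp
  \<comment> \<open>Otherwise the monomial 1 would divide the minimal generator
    \<open>var i ^ c i\<close> properly, as \<open>c i > 0\<close>. This makes the set under
    \<open>Max\<close> below nonempty.\<close>
  have "\<alpha> p \<noteq> 0"
  proof
    assume "\<alpha> p = 0"
    fix i :: 'n
    have "monomial (\<alpha> p) \<in> I" and "Poly_Mapping.single i (c i) \<in> minimal_exponents I"
      using min_exp by (auto simp: minimal_exponents_def)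
    then have "\<alpha> p = Poly_Mapping.single i (c i)"
      using \<open>\<alpha> p = 0\<close> by (auto simp: minimal_exponents_def le_fun_def)
    then have "Poly_Mapping.lookup (\<alpha> p) i = c i"
      by simp
    with \<open>\<alpha> p = 0\<close> assms(3)[of i] show False by simp
  qed
  define m where "m = Max (Poly_Mapping.keys (\<alpha> p))"
  have m_pos: "Poly_Mapping.lookup (\<alpha> p) m > 0"
    using Max_in[of "Poly_Mapping.keys (\<alpha> p)"] \<open>\<alpha> p \<noteq> 0\<close>
    by (simp add: m_def in_keys_iff)
  have m_max: "Poly_Mapping.lookup (\<alpha> p) j = 0" if "j > m" for j
  proof (rule ccontr)
    assume "Poly_Mapping.lookup (\<alpha> p) j \<noteq> 0"
    then have "j \<le> m"
      by (simp add: m_def in_keys_iff)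
    with that show False by simp
  qed
  have small: "Poly_Mapping.lookup (\<alpha> k) m < Poly_Mapping.lookup (\<alpha> p) m"
    if k: "k \<in> {1..p - 1}" for k
  proof -
    have "lex_less (\<alpha> k) (\<alpha> p)"
      using assms(7) k by (auto simp: monotone_on_def)
    then obtain l where l: "\<forall>j>l. Poly_Mapping.lookup (\<alpha> k) j = Poly_Mapping.lookup (\<alpha> p) j"
        "Poly_Mapping.lookup (\<alpha> k) l < Poly_Mapping.lookup (\<alpha> p) l"
      by (auto simp: lex_less_def)
    \<comment> \<open>At the deciding index \<open>l\<close> the entry of \<open>\<alpha> p\<close>
      exceeds another natural number, so it is nonzero.\<close>
    then have "l \<le> m"
      using m_max by (metis not_less not_less_zero)
    then have "Poly_Mapping.lookup (\<alpha> k) m \<le> Poly_Mapping.lookup (\<alpha> p) m"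
      using l by (cases "l = m") auto
    \<comment> \<open>Genericity is applied with \<open>\<alpha> p\<close> in first place, because
      its entry at \<open>m\<close> is known to be nonzero.\<close>
    moreover have "Poly_Mapping.lookup (\<alpha> k) m \<noteq> Poly_Mapping.lookup (\<alpha> p) m"
    proof -
      have "\<alpha> p \<noteq> \<alpha> k" using l(2) by auto
      moreover have "monomial (\<alpha> p) \<in> Min_gens I" "monomial (\<alpha> k) \<in> Min_gens I"
        using k by (auto simp: Min)
      ultimately show ?thesis
        using assms(2) m_pos unfolding generic_def by (metis less_irrefl)
    qed
    ultimately show ?thesis by simp
  qed
  have "card (maximals (- multiples ?E)) \<le> card (maximals (- multiples (insert (\<alpha> p) ?E)))"
    by (rule card_maximals_add_generator[of _ m]) (use small m_pos in auto)
  then show ?thesis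
    unfolding gens I by (subst (1 2) card_Irr_span[of c]) auto
qed

end
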